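(* There exist absolute constants $0<c\le C$ such that for all positive integers $n,r$ with $n\ge 2$, writing $$M(n,r)=\min\left\{n,\ r,\ \sqrt{r\log\left(2+\frac{n^2}{r}\right)}\right\},$$ we have $c\,M(n,r)\le A(n,r)\le C\,M(n,r)$ and $c\,M(n,r)\le B(n,r)\le C\,M(n,r)$. Equivalently, there exist absolute constants $0<c'\le C'$ such that for all positive integers $n,r$ with $n\ge2$ and for each $F\in\{A,B\}$: (i) if $n\le\sqrt{2r}$, then $c' n\le F(n,r)\le C' n$; (ii) if $\sqrt{2r}<n<(1.01)^r$, then $c'\sqrt{r\log(n^2/r)}\le F(n,r)\le C'\sqrt{r\log(n^2/r)}$; (iii) if $n\ge(1.01)^r$, then $c' r\le F(n,r)\le C' r$.
   Context: $\log$ is the natural logarithm and $[r]=\{1,\dots,r\}$. An $r$-edge-colouring of the complete graph $K_n$ is any map $\chi\colon E(K_n)\to[r]$ (not necessarily proper, not necessarily surjective). For $S\subseteq[r]$, $G_\chi[S]$ denotes the spanning subgraph of $K_n$ (on all $n$ vertices) whose edges are the edges with colour in $S$. Define $$A(n,r)=\max_\chi\min\{|S|: S\subseteq[r],\ G_\chi[S]\text{ is connected}\},$$ $$B(n,r)=\max_\chi\min\{|S|: S\subseteq[r],\ G_\chi[S]\text{ has no isolated vertices}\},$$ where the maxima are over all $r$-edge-colourings $\chi$ of $K_n$. *)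

theory Defs
  imports
    Complex_Main
    "HOL-Library.FuncSet"
    "HOL-Library.Ramsey"
    "Graph_Theory.Pair_Digraph"
    "Graph_Theory.Digraph_Component"
begin

text \<open>
  The edges of the complete graph on \<open>{1..n}\<close> are the two-element subsets
  \<open>[{1..n}]\<^bsup>2\<^esup>\<close>. Colourings are extensional functions (undefined off the edges), so that
  there are only finitely many of them.
\<close>

definition edge_colourings :: "nat \<Rightarrow> nat \<Rightarrow> (nat set \<Rightarrow> nat) set" where
  "edge_colourings n r = [{1..n}]\<^bsup>2\<^esup> \<rightarrow>\<^sub>E {1..r}"

text \<open>
  The undirected graph \<open>G\<^sub>\<chi>[S]\<close> is represented by a symmetric loop-free digraph: an edge
  \<open>{u, v}\<close> gives the two arcs \<open>(u, v)\<close> and \<open>(v, u)\<close>.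
\<close>

definition colour_subgraph :: "nat \<Rightarrow> (nat set \<Rightarrow> nat) \<Rightarrow> nat set \<Rightarrow> nat pair_pre_digraph" where
  "colour_subgraph n \<chi> S =
     \<lparr> pverts = {1..n}, parcs = {(u, v). {u, v} \<in> [{1..n}]\<^bsup>2\<^esup> \<and> \<chi> {u, v} \<in> S} \<rparr>"

definition isolated_vertex :: "('a, 'b) pre_digraph \<Rightarrow> 'a \<Rightarrow> bool" where
  "isolated_vertex G v \<longleftrightarrow>
     v \<in> verts G \<and> (\<forall>w. \<not> v \<rightarrow>\<^bsub>G\<^esub> w \<and> \<not> w \<rightarrow>\<^bsub>G\<^esub> v)"

text \<open>
  Qualified because \<open>connected\<close> is also a topological notion in \<open>Complex_Main\<close>.
\<close>

definition A_num :: "nat \<Rightarrow> nat \<Rightarrow> nat" where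
  "A_num n r = (MAX \<chi> \<in> edge_colourings n r.
     Min {card S |S. S \<subseteq> {1..r} \<and>
       Digraph_Component.connected (with_proj (colour_subgraph n \<chi> S))})"

definition B_num :: "nat \<Rightarrow> nat \<Rightarrow> nat" where
  "B_num n r = (MAX \<chi> \<in> edge_colourings n r.
     Min {card S |S. S \<subseteq> {1..r} \<and>
       (\<nexists>v. isolated_vertex (with_proj (colour_subgraph n \<chi> S)) v)})"

definition M_bound :: "nat \<Rightarrow> nat \<Rightarrow> real" where
  "M_bound n r =
     Min {real n, real r, sqrt (real r * ln (2 + (real n)\<^sup>2 / real r))}"

text \<open>
  The next facts show that, for \<open>n \<ge> 2\<close> and \<open>r \<ge> 1\<close>, all maxima and minima above range over
  finite nonempty sets: the full colour set \<open>{1..r}\<close> is always admissible.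
\<close>

lemma finite_edge_colourings: "finite (edge_colourings n r)"
  unfolding edge_colourings_def by (intro finite_PiE finite_imp_finite_nsets) auto

lemma edge_colourings_nonempty: "r \<ge> 1 \<Longrightarrow> edge_colourings n r \<noteq> {}"
  by (auto simp: edge_colourings_def PiE_eq_empty_iff)

lemma finite_card_subsets: "finite {card S |S. S \<subseteq> {1..r::nat} \<and> P S}"
  by (rule finite_subset[of _ "card ` Pow {1..r}"]) auto

lemma doubleton_in_nsets:
  "{u, v} \<in> [{1..n}]\<^bsup>2\<^esup> \<longleftrightarrow> u \<noteq> v \<and> u \<in> {1..n} \<and> v \<in> {1..n::nat}"
  by (auto simp: nsets_def card_2_iff doubleton_eq_iff)

lemma parcs_full:
  assumes "\<chi> \<in> edge_colourings n r"
  shows "parcs (colour_subgraph n \<chi> {1..r}) = {(u, v). u \<noteq> v \<and> u \<in> {1..n} \<and> v \<in> {1..n}}"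
proof -
  have "\<chi> {u, v} \<in> {1..r}" if "{u, v} \<in> [{1..n}]\<^bsup>2\<^esup>" for u v
    using assms that PiE_mem unfolding edge_colourings_def by blast
  then show ?thesis
    unfolding colour_subgraph_def by (auto simp: doubleton_in_nsets)
qed

lemma full_connected:
  assumes "\<chi> \<in> edge_colourings n r" "n \<ge> 1"
  shows "Digraph_Component.connected (with_proj (colour_subgraph n \<chi> {1..r}))"
proof -
  let ?G = "with_proj (colour_subgraph n \<chi> {1..r})"
  let ?H = "with_proj (mk_symmetric ?G)"
  have verts: "verts ?H = {1..n}"
    by (simp add: mk_symmetric_def colour_subgraph_def)
  have "u \<rightarrow>\<^sup>*\<^bsub>?H\<^esub> v" if "u \<in> {1..n}" "v \<in> {1..n}" for u v
  proof (cases "u = v")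
    case True
    then show ?thesis using that verts by (simp add: reachable_def)
  next
    case False
    with that parcs_full[OF assms(1)] have "(u, v) \<in> parcs (colour_subgraph n \<chi> {1..r})"
      by auto
    then have "(u, v) \<in> arcs_ends ?H"
      by (force simp: mk_symmetric_def)
    then show ?thesis
      unfolding reachable_def using that verts
      by (metis rtrancl_on.simps)
  qed
  then show ?thesis
    unfolding Digraph_Component.connected_def strongly_connected_def verts
    using assms(2) by auto
qed

lemma full_no_isolated:
  assumes "\<chi> \<in> edge_colourings n r" "n \<ge> 2"
  shows "\<nexists>v. isolated_vertex (with_proj (colour_subgraph n \<chi> {1..r})) v"
proof
  assume "\<exists>v. isolated_vertex (with_proj (colour_subgraph n \<chi> {1..r})) v"
  then obtain v where v: "v \<in> {1..n}"
    and iso: "\<And>w. (v, w) \<notin> parcs (colour_subgraph n \<chi> {1..r})"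
    by (auto simp: isolated_vertex_def colour_subgraph_def)
  have "(if v = 1 then 2 else 1) \<in> {1..n}" "v \<noteq> (if v = 1 then 2 else 1)"
    using assms(2) by auto
  with v iso parcs_full[OF assms(1)] show False by blast
qed

end

theory Submission
  imports Defs
begin

text \<open>
  The theorem compares the three numbers in the chain
  \<open>M(n, r) / 200 \<le> B(n, r) \<le> A(n, r) \<le> 6 M(n, r)\<close>. The middle inequality holds because a
  connected graph on at least two vertices has no isolated vertex, so only an upper bound for
  \<open>A\<close> and a lower bound for \<open>B\<close> are needed. Write \<open>L = log (2 + n\<^sup>2 / r)\<close>.

  Upper bound. All colours together, and the colours of a star, give \<open>A \<le> r\<close> and \<open>A \<le> n\<close>.
  For \<open>A = O(sqrt (r L))\<close>, chosen colours are contracted greedily, with a set \<open>R\<close> that has a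
  vertex in every component of the current graph. If some vertex of \<open>R\<close> sends fewer than \<open>k\<close>
  colours to the rest of \<open>R\<close>, then these colours join everything to it and the process
  stops. Otherwise every vertex of \<open>R\<close> sees at least \<open>k\<close> of the \<open>r\<close> colours inside \<open>R\<close>, so by
  double counting some colour is seen by at least \<open>k |R| / r\<close> vertices; adding it allows half
  of these to be dropped from \<open>R\<close> (\<open>absorbs_contract\<close>). After \<open>k\<close> rounds with
  \<open>k\<close> about \<open>sqrt (r L)\<close>, at most \<open>n exp (- k\<^sup>2 / (2 r)) \<le> n exp (- L / 2) \<le> sqrt r\<close>
  vertices are left in \<open>R\<close>, and one more star joins them.

  Lower bound. Take an intersecting family of subsets of a \<open>q\<close>-element set in which every set that
  meets all members has at least \<open>k\<close> elements; the subsets of size more than \<open>k\<close> of a set of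
  size \<open>q = 2 k\<close> will do, and there are at most \<open>4\<^sup>k\<close> of them. The vertices are pairs of a
  block \<open>i < g\<close> and a member \<open>T\<close> of the family, and the edge between \<open>(i, T)\<close> and \<open>(j, T')\<close> is
  coloured by the pair \<open>{i, j}\<close> and a common element of \<open>T\<close> and \<open>T'\<close>. If no vertex is isolated,
  then for every block the second components of the chosen colours that involve this block
  meet all members of the family, so there are at least \<open>k\<close> such colours; as a colour involves
  at most two blocks, at least \<open>g k / 2\<close> colours are chosen
  (\<open>B_num_ge_intersecting_family\<close>). This needs \<open>g 4\<^sup>k\<close> vertices and \<open>2 k g\<^sup>2\<close> colours. With
  \<open>k\<close> of order \<open>min (log (n\<^sup>2 / r)) r\<close> and \<open>g\<close> of order \<open>sqrt (r / k)\<close> the bound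
  \<open>g k / 2\<close> has the order of \<open>M(n, r)\<close>. The blocks make the bound tight when \<open>n\<close> is
  close to \<open>sqrt r\<close>: passing from one block to \<open>g\<close> of them multiplies \<open>n\<close> by \<open>g\<close> and \<open>r\<close> by
  \<open>g\<^sup>2\<close>, which leaves \<open>n\<^sup>2 / r\<close> unchanged, while the number of colours required grows like \<open>g\<close>.

  The three regimes follow by evaluating \<open>M(n, r)\<close> in each of them up to constants.
\<close>

section \<open>Colour subgraphs as relations\<close>

text \<open>
  The arcs of \<open>colour_subgraph\<close> as a plain relation, so that connectivity becomes a statement
  about its reflexive transitive closure.
\<close>
definition coloured_arcs :: "nat \<Rightarrow> (nat set \<Rightarrow> nat) \<Rightarrow> nat set \<Rightarrow> (nat \<times> nat) set" where
  "coloured_arcs n \<chi> S =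
     {(u, v). u \<in> {1..n} \<and> v \<in> {1..n} \<and> u \<noteq> v \<and> \<chi> {u, v} \<in> S}"

lemma sym_coloured_arcs: "sym (coloured_arcs n \<chi> S)"
  by (auto simp: sym_def coloured_arcs_def insert_commute)

lemma parcs_colour_subgraph: "parcs (colour_subgraph n \<chi> S) = coloured_arcs n \<chi> S"
  unfolding colour_subgraph_def coloured_arcs_def doubleton_in_nsets by auto

lemma connected_colour_subgraph_iff:
  assumes "n \<ge> 1"
  shows "Digraph_Component.connected (with_proj (colour_subgraph n \<chi> S)) \<longleftrightarrow>
    (\<forall>u\<in>{1..n}. \<forall>v\<in>{1..n}. (u, v) \<in> (coloured_arcs n \<chi> S)\<^sup>*)"
proof -
  let ?H = "with_proj (mk_symmetric (with_proj (colour_subgraph n \<chi> S)))"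
  have ends: "arcs_ends ?H = coloured_arcs n \<chi> S"
    using sym_coloured_arcs[of n \<chi> S]
    by (auto simp: mk_symmetric_def parcs_colour_subgraph sym_def)
  have verts: "verts ?H = {1..n}"
    by (simp add: mk_symmetric_def colour_subgraph_def)
  have "(u, v) \<in> rtrancl_on {1..n} (coloured_arcs n \<chi> S)"
    if "(u, v) \<in> (coloured_arcs n \<chi> S)\<^sup>*" "u \<in> {1..n}" "v \<in> {1..n}" for u v
    using that by (rule rtrancl_consistent_rtrancl_on) (auto simp: coloured_arcs_def)
  then have "u \<rightarrow>\<^sup>*\<^bsub>?H\<^esub> v \<longleftrightarrow> (u, v) \<in> (coloured_arcs n \<chi> S)\<^sup>*"
    if "u \<in> {1..n}" "v \<in> {1..n}" for u v
    unfolding reachable_def ends verts using that by (blast intro: rtrancl_on_rtranclI)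
  then show ?thesis
    unfolding Digraph_Component.connected_def strongly_connected_def verts
    using assms by auto
qed

lemma no_isolated_colour_subgraph_iff:
  "(\<nexists>v. isolated_vertex (with_proj (colour_subgraph n \<chi> S)) v) \<longleftrightarrow>
    (\<forall>v\<in>{1..n}. \<exists>w. (v, w) \<in> coloured_arcs n \<chi> S)"
proof -
  have "(w, v) \<in> coloured_arcs n \<chi> S \<longleftrightarrow> (v, w) \<in> coloured_arcs n \<chi> S" for v w
    using sym_coloured_arcs by (meson symD)
  then have "isolated_vertex (with_proj (colour_subgraph n \<chi> S)) v \<longleftrightarrow>
      v \<in> {1..n} \<and> (\<forall>w. (v, w) \<notin> coloured_arcs n \<chi> S)" for v
    unfolding isolated_vertex_def by (simp add: parcs_colour_subgraph) (simp add: colour_subgraph_def)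
  then show ?thesis by blast
qed

lemma connected_no_isolated:
  assumes "n \<ge> 2" "Digraph_Component.connected (with_proj (colour_subgraph n \<chi> S))"
  shows "\<nexists>v. isolated_vertex (with_proj (colour_subgraph n \<chi> S)) v"
  unfolding no_isolated_colour_subgraph_iff
proof
  fix v assume v: "v \<in> {1..n}"
  obtain w where w: "w \<in> {1..n}" "w \<noteq> v"
    using assms(1) v by (cases "v = 1") (auto intro: that[of 1] that[of 2])
  then have "(v, w) \<in> (coloured_arcs n \<chi> S)\<^sup>*"
    using assms(2) v connected_colour_subgraph_iff[of n \<chi> S] assms(1) by force
  then show "\<exists>w. (v, w) \<in> coloured_arcs n \<chi> S"
    using w(2) by (auto elim: converse_rtranclE)
qed

lemma A_num_le:
  assumes "n \<ge> 1" "r \<ge> 1"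
    and "\<And>\<chi>. \<chi> \<in> edge_colourings n r \<Longrightarrow>
      \<exists>S\<subseteq>{1..r}. Digraph_Component.connected (with_proj (colour_subgraph n \<chi> S)) \<and> card S \<le> b"
  shows "A_num n r \<le> b"
  unfolding A_num_def
proof (rule Max.boundedI)
  fix a assume "a \<in> (\<lambda>\<chi>. Min {card S |S. S \<subseteq> {1..r} \<and>
      Digraph_Component.connected (with_proj (colour_subgraph n \<chi> S))}) ` edge_colourings n r"
  then obtain \<chi> where \<chi>: "\<chi> \<in> edge_colourings n r" and a: "a = Min {card S |S. S \<subseteq> {1..r} \<and>
      Digraph_Component.connected (with_proj (colour_subgraph n \<chi> S))}"
    by auto
  obtain S where S: "S \<subseteq> {1..r}" "card S \<le> b"
      "Digraph_Component.connected (with_proj (colour_subgraph n \<chi> S))"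
    using assms(3)[OF \<chi>] by blast
  have "a \<le> card S"
    unfolding a by (intro Min_le finite_card_subsets) (use S in blast)
  with S show "a \<le> b" by simp
qed (use assms edge_colourings_nonempty finite_edge_colourings in auto)

lemma B_num_ge:
  assumes "n \<ge> 2" "\<chi> \<in> edge_colourings n r"
    and "\<And>S. S \<subseteq> {1..r} \<Longrightarrow> \<forall>v\<in>{1..n}. \<exists>w. (v, w) \<in> coloured_arcs n \<chi> S \<Longrightarrow> b \<le> card S"
  shows "b \<le> B_num n r"
proof -
  let ?M = "\<lambda>\<chi>. {card S |S. S \<subseteq> {1..r} \<and>
       (\<nexists>v. isolated_vertex (with_proj (colour_subgraph n \<chi> S)) v)}"
  have "card {1..r} \<in> ?M \<chi>"
    using full_no_isolated[OF assms(2,1)] by blast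
  then have "b \<le> Min (?M \<chi>)"
    using assms(3) unfolding no_isolated_colour_subgraph_iff
    by (subst Min_ge_iff) (auto intro: finite_card_subsets)
  also have "\<dots> \<le> B_num n r"
    unfolding B_num_def using assms(2) finite_edge_colourings by (intro Max_ge) auto
  finally show ?thesis .
qed

lemma B_num_le_A_num:
  assumes "n \<ge> 2" "r \<ge> 1"
  shows "B_num n r \<le> A_num n r"
  unfolding B_num_def
proof (rule Max.boundedI)
  fix b assume "b \<in> (\<lambda>\<chi>. Min {card S |S. S \<subseteq> {1..r} \<and>
      (\<nexists>v. isolated_vertex (with_proj (colour_subgraph n \<chi> S)) v)}) ` edge_colourings n r"
  then obtain \<chi> where \<chi>: "\<chi> \<in> edge_colourings n r" and b: "b = Min {card S |S. S \<subseteq> {1..r} \<and>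
      (\<nexists>v. isolated_vertex (with_proj (colour_subgraph n \<chi> S)) v)}"
    by auto
  have "card {1..r} \<in> {card S |S. S \<subseteq> {1..r} \<and>
      Digraph_Component.connected (with_proj (colour_subgraph n \<chi> S))}"
    using full_connected[OF \<chi>] assms by fastforce
  then have "b \<le> Min {card S |S. S \<subseteq> {1..r} \<and>
      Digraph_Component.connected (with_proj (colour_subgraph n \<chi> S))}"
    unfolding b using connected_no_isolated[OF assms(1)]
    by (intro Min_antimono finite_card_subsets) auto
  also have "\<dots> \<le> A_num n r"
    unfolding A_num_def using \<chi> finite_edge_colourings by (intro Max_ge) auto
  finally show "b \<le> A_num n r" .
qed (use assms edge_colourings_nonempty finite_edge_colourings in auto)

lemma B_num_ge_1:
  assumes "n \<ge> 2" "r \<ge> 1"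
  shows "1 \<le> B_num n r"
proof -
  obtain \<chi> where \<chi>: "\<chi> \<in> edge_colourings n r"
    using edge_colourings_nonempty[OF assms(2)] by blast
  show ?thesis
  proof (rule B_num_ge[OF assms(1) \<chi>])
    fix S assume S: "S \<subseteq> {1..r}" "\<forall>v\<in>{1..n}. \<exists>w. (v, w) \<in> coloured_arcs n \<chi> S"
    have "1 \<in> {1..n}" using assms by simp
    then obtain w where "(1, w) \<in> coloured_arcs n \<chi> S" using S(2) by blast
    then have "S \<noteq> {}" unfolding coloured_arcs_def by blast
    moreover have "finite S" using S(1) finite_subset by blast
    ultimately show "1 \<le> card S" by (simp add: Suc_le_eq card_gt_0_iff)
  qed
qed

section \<open>The upper bound\<close>

text \<open>
  A graph without isolated vertices has a dominating set of at most half its size. The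
  complement \<open>D\<close> of such a set is taken to be a largest set whose members all have a neighbour
  outside. A vertex outside \<open>D\<close> without a neighbour in \<open>D\<close> could be added to \<open>D\<close>; hence the
  complement of \<open>D\<close> has the same property as \<open>D\<close>, and is no larger than \<open>D\<close> by maximality.
\<close>
lemma half_with_outside_neighbours:
  assumes "finite U" and sym: "\<And>u w. N u w \<Longrightarrow> N w u" and irrefl: "\<And>u. \<not> N u u"
    and nbr: "\<And>u. u \<in> U \<Longrightarrow> \<exists>w\<in>U. N u w"
  obtains D where "D \<subseteq> U" "card U \<le> 2 * card D" "\<And>d. d \<in> D \<Longrightarrow> \<exists>w\<in>U - D. N d w"
proof -
  define splits where "splits D \<longleftrightarrow> D \<subseteq> U \<and> (\<forall>d\<in>D. \<exists>w\<in>U - D. N d w)" for D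
  have "\<exists>D. splits D \<and> (\<forall>D'. splits D' \<longrightarrow> card D' \<le> card D)"
  proof (rule ex_has_greatest_nat[where P = splits and f = card and k = "{}" and b = "Suc (card U)"])
    show "splits {}" by (simp add: splits_def)
    show "\<forall>D. splits D \<longrightarrow> card D < Suc (card U)"
      using card_mono[OF assms(1)] unfolding less_Suc_eq_le splits_def by blast
  qed
  then obtain D where D: "splits D" and max: "\<forall>D'. splits D' \<longrightarrow> card D' \<le> card D" by blast
  have DU: "D \<subseteq> U" and out: "\<And>d. d \<in> D \<Longrightarrow> \<exists>w\<in>U - D. N d w"
    using D by (simp_all add: splits_def)
  have finD: "finite D" using DU assms(1) by (rule finite_subset)
  have inside: "\<exists>d\<in>D. N w d" if w: "w \<in> U - D" for w
  proof (rule ccontr)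
    assume no: "\<not> (\<exists>d\<in>D. N w d)"
    have "\<exists>x\<in>U - insert w D. N d x" if d: "d \<in> insert w D" for d
    proof (cases "d = w")
      case True
      obtain x where x: "x \<in> U" "N w x" using nbr[of w] w by auto
      have "x \<noteq> w" using x(2) irrefl by auto
      moreover have "x \<notin> D" using x(2) no by auto
      ultimately show ?thesis using x True by auto
    next
      case False
      then obtain x where x: "x \<in> U - D" "N d x" using out[of d] d by auto
      have "x \<noteq> w" using sym[of d x] x(2) no d False by blast
      then show ?thesis using x by auto
    qed
    then have "splits (insert w D)"
      unfolding splits_def using DU w by simp
    then have "card (insert w D) \<le> card D" by (rule max[rule_format])
    then show False using w finD by simp
  qed
  have "U - (U - D) = D" using DU by auto
  then have "splits (U - D)" unfolding splits_def using inside by simp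
  then have "card (U - D) \<le> card D" by (rule max[rule_format])
  then have "card U \<le> 2 * card D"
    using DU finD by (simp add: card_Diff_subset)
  then show ?thesis using that[OF DU _ out] by simp
qed

text \<open>
  This says that \<open>R\<close> meets every component of the graph in the colours \<open>S\<close>. Working with
  such representatives replaces the contraction of components.
\<close>
definition absorbs :: "nat \<Rightarrow> (nat set \<Rightarrow> nat) \<Rightarrow> nat set \<Rightarrow> nat set \<Rightarrow> bool" where
  "absorbs n \<chi> S R \<longleftrightarrow>
     R \<subseteq> {1..n} \<and> (\<forall>v\<in>{1..n}. \<exists>u\<in>R. (v, u) \<in> (coloured_arcs n \<chi> S)\<^sup>*)"

lemma rtrancl_coloured_arcs_mono:
  assumes "(u, v) \<in> (coloured_arcs n \<chi> S)\<^sup>*" "S \<subseteq> T"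
  shows "(u, v) \<in> (coloured_arcs n \<chi> T)\<^sup>*"
proof -
  have "coloured_arcs n \<chi> S \<subseteq> coloured_arcs n \<chi> T"
    using assms(2) by (auto simp: coloured_arcs_def)
  then show ?thesis using assms(1) rtrancl_mono by blast
qed

text \<open>
  Joining one representative \<open>u\<close> to all the others joins it to every vertex. This is used both
  when \<open>u\<close> sees few colours and when few representatives are left.
\<close>
lemma star_connects:
  assumes "absorbs n \<chi> S R" "u \<in> R"
  shows "Digraph_Component.connected
    (with_proj (colour_subgraph n \<chi> (S \<union> (\<lambda>w. \<chi> {u, w}) ` (R - {u}))))"
proof -
  let ?T = "S \<union> (\<lambda>w. \<chi> {u, w}) ` (R - {u})"
  have R: "R \<subseteq> {1..n}" using assms(1) by (simp add: absorbs_def)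
  then have n: "n \<ge> 1" using assms(2) by auto
  have to_u: "(v, u) \<in> (coloured_arcs n \<chi> ?T)\<^sup>*" if v: "v \<in> {1..n}" for v
  proof -
    obtain w where w: "w \<in> R" "(v, w) \<in> (coloured_arcs n \<chi> S)\<^sup>*"
      using assms(1) v unfolding absorbs_def by blast
    have "w = u \<or> (w, u) \<in> coloured_arcs n \<chi> ?T"
      using w(1) assms(2) R by (auto simp: coloured_arcs_def insert_commute)
    then show ?thesis
      using rtrancl_coloured_arcs_mono[OF w(2), of ?T] by (blast intro: rtrancl_into_rtrancl)
  qed
  have "sym ((coloured_arcs n \<chi> ?T)\<^sup>*)" by (intro sym_rtrancl sym_coloured_arcs)
  then show ?thesis
    unfolding connected_colour_subgraph_iff[OF n] using to_u
    by (meson rtrancl_trans symD)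
qed

lemma colour_in_range:
  assumes "\<chi> \<in> edge_colourings n r" "u \<in> {1..n}" "w \<in> {1..n}" "u \<noteq> w"
  shows "\<chi> {u, w} \<in> {1..r}"
proof -
  have "{u, w} \<in> [{1..n}]\<^bsup>2\<^esup>" using assms by (simp add: doubleton_in_nsets)
  then show ?thesis using assms(1) unfolding edge_colourings_def by (rule PiE_mem[rotated])
qed

text \<open>
  Double counting of the pairs of a vertex of \<open>R\<close> and a colour that it sees inside \<open>R\<close>: there are
  at least \<open>k * card R\<close> of them, spread over \<open>r\<close> colours.
\<close>
lemma popular_colour:
  assumes \<chi>: "\<chi> \<in> edge_colourings n r" and "r \<ge> 1" and R: "R \<subseteq> {1..n}"
    and many: "\<And>u. u \<in> R \<Longrightarrow> k \<le> card ((\<lambda>w. \<chi> {u, w}) ` (R - {u}))"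
  obtains c where "c \<in> {1..r}" "k * card R \<le> r * card {u\<in>R. \<exists>w\<in>R - {u}. \<chi> {u, w} = c}"
proof (rule ccontr)
  note choose = that
  let ?sees = "\<lambda>u c. \<exists>w\<in>R - {u}. \<chi> {u, w} = c"
  assume none: "\<not> thesis"
  have less: "r * card {u\<in>R. ?sees u c} < k * card R" if c: "c \<in> {1..r}" for c
  proof (rule ccontr)
    assume "\<not> ?thesis"
    then have "k * card R \<le> r * card {u\<in>R. ?sees u c}" by simp
    from none choose[OF c this] show False by blast
  qed
  have fin: "finite R" using R finite_subset by blast
  have "{c\<in>{1..r}. ?sees u c} = (\<lambda>w. \<chi> {u, w}) ` (R - {u})" if u: "u \<in> R" for u
  proof -
    have "\<chi> {u, w} \<in> {1..r}" if "w \<in> R - {u}" for w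
      by (rule colour_in_range[OF \<chi>]) (use that u R in blast)+
    then show ?thesis by blast
  qed
  then have "k * card R \<le> (\<Sum>u\<in>R. card {c\<in>{1..r}. ?sees u c})"
    using many by (subst mult.commute) (intro sum_bounded_below[of R k, simplified], simp)
  also have "\<dots> = (\<Sum>c\<in>{1..r}. card {u\<in>R. ?sees u c})"
    using fin by (intro sum_multicount_gen) auto
  finally have "r * (k * card R) \<le> (\<Sum>c\<in>{1..r}. r * card {u\<in>R. ?sees u c})"
    unfolding sum_distrib_left[symmetric] by (rule mult_le_mono2)
  also have "\<dots> < (\<Sum>c\<in>{1..r}. k * card R)"
    using less assms(2) by (intro sum_strict_mono) auto
  finally show False by simp
qed

text \<open>
  One round of the greedy contraction. The vertices that see a popular colour \<open>c\<close> inside \<open>R\<close> form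
  a graph without isolated vertices; half of them are adjacent in colour \<open>c\<close> to the other
  half and stop being representatives once \<open>c\<close> is chosen. So \<open>R\<close> shrinks by the factor
  \<open>1 - k / (2 r)\<close>, which is bounded by the exponential.
\<close>
lemma absorbs_contract:
  assumes \<chi>: "\<chi> \<in> edge_colourings n r" and r: "r \<ge> 1" and abs: "absorbs n \<chi> S R"
    and many: "\<And>u. u \<in> R \<Longrightarrow> k \<le> card ((\<lambda>w. \<chi> {u, w}) ` (R - {u}))"
  obtains c R' where "c \<in> {1..r}" "absorbs n \<chi> (insert c S) R'"
    "real (card R') \<le> exp (- (real k / (2 * real r))) * real (card R)"
proof -
  have R: "R \<subseteq> {1..n}" using abs by (simp add: absorbs_def)
  then have fin: "finite R" using finite_subset by blast
  obtain c where c: "c \<in> {1..r}" "k * card R \<le> r * card {u\<in>R. \<exists>w\<in>R - {u}. \<chi> {u, w} = c}"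
    using popular_colour[OF \<chi> r R many] by blast
  define U where "U = {u\<in>R. \<exists>w\<in>R - {u}. \<chi> {u, w} = c}"
  obtain D where D: "D \<subseteq> U" "card U \<le> 2 * card D"
      "\<And>d. d \<in> D \<Longrightarrow> \<exists>w\<in>U - D. d \<noteq> w \<and> \<chi> {d, w} = c"
  proof (rule half_with_outside_neighbours[of U "\<lambda>d w. d \<noteq> w \<and> \<chi> {d, w} = c"])
    show "finite U" using fin by (simp add: U_def)
    show "\<exists>w\<in>U. u \<noteq> w \<and> \<chi> {u, w} = c" if uU: "u \<in> U" for u
    proof -
      obtain w where w: "w \<in> R" "w \<noteq> u" "\<chi> {u, w} = c" and u: "u \<in> R"
        using uU unfolding U_def by blast
      have "\<chi> {w, u} = c" using w(3) by (simp only: insert_commute)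
      then have "w \<in> U" using w u unfolding U_def by blast
      then show ?thesis using w(2,3) by (intro bexI[of _ w]) auto
    qed
  qed (auto simp: insert_commute)
  have DR: "D \<subseteq> R" using D(1) by (auto simp: U_def)
  have "absorbs n \<chi> (insert c S) (R - D)"
    unfolding absorbs_def
  proof (intro conjI ballI)
    show "R - D \<subseteq> {1..n}" using R by auto
    fix v assume "v \<in> {1..n}"
    then obtain u where u: "u \<in> R" "(v, u) \<in> (coloured_arcs n \<chi> S)\<^sup>*"
      using abs unfolding absorbs_def by blast
    have vu: "(v, u) \<in> (coloured_arcs n \<chi> (insert c S))\<^sup>*"
      by (rule rtrancl_coloured_arcs_mono[OF u(2)]) auto
    show "\<exists>w\<in>R - D. (v, w) \<in> (coloured_arcs n \<chi> (insert c S))\<^sup>*"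
    proof (cases "u \<in> D")
      case True
      from D(3)[OF this] obtain w where w: "w \<in> U - D" "u \<noteq> w" "\<chi> {u, w} = c" by blast
      then have "w \<in> R - D" by (auto simp: U_def)
      moreover have "(u, w) \<in> coloured_arcs n \<chi> (insert c S)"
        using u(1) R w \<open>w \<in> R - D\<close> by (auto simp: coloured_arcs_def)
      ultimately show ?thesis using rtrancl_into_rtrancl[OF vu] by blast
    next
      case False
      with u vu show ?thesis by blast
    qed
  qed
  moreover have "real (card (R - D)) \<le> exp (- (real k / (2 * real r))) * real (card R)"
  proof -
    have "k * card R \<le> r * (2 * card D)"
      using c(2) mult_le_mono2[OF D(2), of r] unfolding U_def by linarith
    then have "real (k * card R) \<le> real (r * (2 * card D))" by (rule of_nat_mono)
    then have "real k / (2 * real r) * real (card R) \<le> real (card D)"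
      using r by (simp add: field_simps)
    moreover have "real (card (R - D)) = real (card R) - real (card D)"
      using card_Diff_subset[OF finite_subset[OF DR fin] DR] card_mono[OF fin DR]
      by (simp add: of_nat_diff)
    ultimately have "real (card (R - D)) \<le> (1 + - (real k / (2 * real r))) * real (card R)"
      by (simp add: algebra_simps)
    also have "\<dots> \<le> exp (- (real k / (2 * real r))) * real (card R)"
      by (intro mult_right_mono exp_ge_add_one_self) auto
    finally show ?thesis .
  qed
  ultimately show ?thesis using c(1) that by blast
qed

text \<open>
  If \<open>j + k\<close> colours never suffice for connectivity, then no representative ever sees fewer than \<open>k\<close>
  colours among the representatives, and the contraction can be repeated \<open>j\<close> times.
\<close>
lemma absorbs_iterate:
  assumes \<chi>: "\<chi> \<in> edge_colourings n r" and r: "r \<ge> 1"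
    and none: "\<nexists>S. S \<subseteq> {1..r} \<and> card S \<le> j + k \<and>
      Digraph_Component.connected (with_proj (colour_subgraph n \<chi> S))"
  shows "\<exists>S R. S \<subseteq> {1..r} \<and> card S \<le> j \<and> absorbs n \<chi> S R \<and>
    real (card R) \<le> exp (- (real j * real k / (2 * real r))) * real n"
  using none
proof (induction j)
  case 0
  have "absorbs n \<chi> {} {1..n}" by (auto simp: absorbs_def)
  then show ?case by (intro exI[of _ "{}"] exI[of _ "{1..n}"]) auto
next
  case (Suc j)
  then obtain S R where S: "S \<subseteq> {1..r}" "card S \<le> j" "absorbs n \<chi> S R"
    and card: "real (card R) \<le> exp (- (real j * real k / (2 * real r))) * real n"
    by force
  have R: "R \<subseteq> {1..n}" using S(3) by (simp add: absorbs_def)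
  have "k \<le> card ((\<lambda>w. \<chi> {u, w}) ` (R - {u}))" if u: "u \<in> R" for u
  proof (rule ccontr)
    let ?X = "(\<lambda>w. \<chi> {u, w}) ` (R - {u})"
    assume "\<not> k \<le> card ?X"
    then have "card (S \<union> ?X) \<le> Suc j + k"
      using S(2) card_Un_le[of S ?X] by simp
    moreover have "S \<union> ?X \<subseteq> {1..r}"
      using S(1) R u colour_in_range[OF \<chi>] by blast
    ultimately show False using Suc.prems star_connects[OF S(3) u] by blast
  qed
  then obtain c R' where c: "c \<in> {1..r}" "absorbs n \<chi> (insert c S) R'"
    "real (card R') \<le> exp (- (real k / (2 * real r))) * real (card R)"
    using absorbs_contract[OF \<chi> r S(3)] by blast
  note c(3)
  also have "exp (- (real k / (2 * real r))) * real (card R) \<le>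
    exp (- (real k / (2 * real r))) * (exp (- (real j * real k / (2 * real r))) * real n)"
    using card by (intro mult_left_mono) auto
  also have "\<dots> = exp (- (real (Suc j) * real k / (2 * real r))) * real n"
    by (simp add: ring_distribs add_divide_distrib flip: exp_add)
  finally have "real (card R') \<le> exp (- (real (Suc j) * real k / (2 * real r))) * real n" .
  moreover have "card (insert c S) \<le> Suc j"
    using S(2) card_insert_le_m1[of "Suc j" S c] by simp
  ultimately show ?case using c S(1) by (intro exI[of _ "insert c S"] exI[of _ R']) auto
qed

lemma connecting_colours:
  assumes \<chi>: "\<chi> \<in> edge_colourings n r" and r: "r \<ge> 1" and n: "n \<ge> 1"
  shows "\<exists>S\<subseteq>{1..r}. Digraph_Component.connected (with_proj (colour_subgraph n \<chi> S)) \<and>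
    card S \<le> j + max k (nat \<lfloor>exp (- (real j * real k / (2 * real r))) * real n\<rfloor>)"
proof (cases "\<exists>S. S \<subseteq> {1..r} \<and> card S \<le> j + k \<and>
    Digraph_Component.connected (with_proj (colour_subgraph n \<chi> S))")
  case True
  then obtain S where S: "S \<subseteq> {1..r}" "card S \<le> j + k"
    "Digraph_Component.connected (with_proj (colour_subgraph n \<chi> S))" by blast
  have "card S \<le> j + max k (nat \<lfloor>exp (- (real j * real k / (2 * real r))) * real n\<rfloor>)"
    using S(2) by simp
  with S(1,3) show ?thesis by blast
next
  case False
  obtain S R where S: "S \<subseteq> {1..r}" "card S \<le> j" "absorbs n \<chi> S R"
    and card: "real (card R) \<le> exp (- (real j * real k / (2 * real r))) * real n"
    using absorbs_iterate[OF \<chi> r False] by blast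
  have R: "R \<subseteq> {1..n}" using S(3) by (simp add: absorbs_def)
  have "1 \<in> {1..n}" using n by simp
  then obtain u where u: "u \<in> R" using S(3) unfolding absorbs_def by blast
  let ?X = "(\<lambda>w. \<chi> {u, w}) ` (R - {u})"
  have fin: "finite R" using R finite_subset by blast
  have "card ?X \<le> card (R - {u})" using fin by (intro card_image_le) auto
  also have "\<dots> \<le> card R" using fin by (intro card_mono) auto
  also have "\<dots> \<le> nat \<lfloor>exp (- (real j * real k / (2 * real r))) * real n\<rfloor>"
    using card by (simp add: le_nat_floor)
  finally have "card (S \<union> ?X) \<le> j + max k (nat \<lfloor>exp (- (real j * real k / (2 * real r))) * real n\<rfloor>)"
    using S(2) card_Un_le[of S ?X] by simp
  moreover have "S \<union> ?X \<subseteq> {1..r}"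
    using S(1) R u colour_in_range[OF \<chi>] by blast
  ultimately show ?thesis using star_connects[OF S(3) u] by blast
qed

lemma A_num_le_r:
  assumes "n \<ge> 1" "r \<ge> 1"
  shows "A_num n r \<le> r"
proof (rule A_num_le[OF assms])
  fix \<chi> assume \<chi>: "\<chi> \<in> edge_colourings n r"
  have "card {1..r} \<le> r" by simp
  with full_connected[OF \<chi> assms(1)]
  show "\<exists>S\<subseteq>{1..r}. Digraph_Component.connected (with_proj (colour_subgraph n \<chi> S)) \<and> card S \<le> r"
    by blast
qed

lemma A_num_le_n:
  assumes "n \<ge> 1" "r \<ge> 1"
  shows "A_num n r \<le> n"
proof (rule A_num_le[OF assms])
  fix \<chi> assume "\<chi> \<in> edge_colourings n r"
  from connecting_colours[OF this assms(2,1), of 0 0]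
  show "\<exists>S\<subseteq>{1..r}. Digraph_Component.connected (with_proj (colour_subgraph n \<chi> S)) \<and> card S \<le> n"
    by simp
qed

lemma ln_2_ge_half: "1 / 2 \<le> ln (2::real)"
  using ln_le_minus_one[of "1 / 2 :: real"] by (simp add: ln_div)

text \<open>
  The choice \<open>j = k = \<lceil>sqrt (r L)\<rceil>\<close> balances the three costs in \<open>connecting_colours\<close>: the \<open>j\<close>
  colours of the contraction, the \<open>k\<close> colours of an early stop, and the final star, whose
  size \<open>n exp (- j k / (2 r)) \<le> n exp (- L / 2)\<close> is at most \<open>sqrt r\<close> since
  \<open>exp L = 2 + n\<^sup>2 / r\<close>.
\<close>
lemma A_num_le_sqrt:
  assumes "n \<ge> 1" "r \<ge> 1"
  shows "real (A_num n r) \<le> 6 * sqrt (real r * ln (2 + (real n)\<^sup>2 / real r))"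
proof -
  define L where "L = ln (2 + (real n)\<^sup>2 / real r)"
  define X where "X = sqrt (real r * L)"
  define k where "k = nat \<lceil>X\<rceil>"
  have "ln (2::real) \<le> L" unfolding L_def using assms by (subst ln_le_cancel_iff) (auto intro: add_pos_nonneg)
  then have L: "1 / 2 \<le> L" using ln_2_ge_half by linarith
  \<comment> \<open>The summand 2 in the logarithm keeps \<open>L\<close> away from 0, so that \<open>sqrt r\<close> and the rounding
    of \<open>X\<close> to an integer cost only a constant factor.\<close>
  have rL: "real r * L > 0" "real r * (1 / 2) \<le> real r * L"
    using L assms by (auto intro: mult_left_mono)
  have X2: "X\<^sup>2 = real r * L" unfolding X_def using rL by simp
  have X0: "X > 0" unfolding X_def using rL by simp
  have "(2 * X)\<^sup>2 \<ge> real r" using X2 rL by (simp add: power_mult_distrib)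
  then have sqrt_r: "sqrt (real r) \<le> 2 * X" using X0 real_le_lsqrt by simp
  moreover have "1 \<le> sqrt (real r)" using assms by simp
  ultimately have k: "X \<le> real k" "real k \<le> 3 * X"
    unfolding k_def using X0 by linarith+
  have "X\<^sup>2 \<le> (real k)\<^sup>2" using k X0 by (intro power_mono) auto
  then have "L / 2 \<le> real k * real k / (2 * real r)"
    unfolding X2 using assms by (simp add: field_simps power2_eq_square)
  then have "exp (- (real k * real k / (2 * real r))) * real n \<le> exp (- (L / 2)) * real n"
    by (intro mult_right_mono) auto
  also have "\<dots> \<le> sqrt (real r)"
  proof (rule real_le_rsqrt)
    have "(exp (- (L / 2)))\<^sup>2 = exp (- L)" by (simp add: power2_eq_square flip: exp_add)
    also have "\<dots> = 1 / (2 + (real n)\<^sup>2 / real r)"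
      unfolding L_def using assms by (subst exp_minus, subst exp_ln) (auto simp: field_simps intro: add_pos_nonneg)
    finally show "(exp (- (L / 2)) * real n)\<^sup>2 \<le> real r"
      using assms by (simp add: power_mult_distrib field_simps add_pos_nonneg)
  qed
  finally have small: "real (nat \<lfloor>exp (- (real k * real k / (2 * real r))) * real n\<rfloor>) \<le> 2 * X"
    using sqrt_r X0 by linarith
  have "A_num n r \<le> k + max k (nat \<lfloor>exp (- (real k * real k / (2 * real r))) * real n\<rfloor>)"
    using connecting_colours[OF _ assms(2,1), of _ k k] by (intro A_num_le assms)
  then have "real (A_num n r) \<le> 6 * X" using k small X0 by (simp add: max_def split: if_splits)
  then show ?thesis unfolding X_def L_def .
qed

section \<open>The lower bound\<close>

lemma sum_card_fibres_le:
  assumes "finite S" "finite I"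
  shows "(\<Sum>i\<in>I. card {s\<in>S. f s = i}) \<le> card S"
proof -
  have "(\<Sum>i\<in>I. card {s\<in>S. f s = i}) = card (\<Union>i\<in>I. {s\<in>S. f s = i})"
    using assms by (subst card_UN_disjoint) auto
  also have "\<dots> \<le> card S"
    using assms by (intro card_mono) auto
  finally show ?thesis .
qed

lemma labelling_exists:
  assumes "finite P" "P \<noteq> {}" "finite V" "card P \<le> card V"
  shows "\<exists>h. h ` V = P"
proof -
  obtain f where f: "f ` P \<subseteq> V" "inj_on f P"
    using card_le_inj[OF assms(1,3,4)] by blast
  obtain p where p: "p \<in> P" using assms(2) by blast
  define h where "h v = (if v \<in> f ` P then inv_into P f v else p)" for v
  have "h v \<in> P" for v unfolding h_def using p inv_into_into[of v f P] by simp
  moreover have "x \<in> h ` V" if x: "x \<in> P" for x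
  proof -
    have "h (f x) = x" unfolding h_def using x f(2) by simp
    moreover have "f x \<in> V" using f(1) x by blast
    ultimately show ?thesis by (metis image_eqI)
  qed
  ultimately have "h ` V = P" by blast
  then show ?thesis by blast
qed

lemma colouring_from_symmetric:
  fixes col :: "nat \<Rightarrow> nat \<Rightarrow> nat"
  assumes sym: "\<And>u v. col u v = col v u"
    and range: "\<And>u v. u \<in> {1..n} \<Longrightarrow> v \<in> {1..n} \<Longrightarrow> col u v \<in> {1..r}"
  shows "\<exists>\<chi>\<in>edge_colourings n r.
    \<forall>u\<in>{1..n}. \<forall>v\<in>{1..n}. u \<noteq> v \<longrightarrow> \<chi> {u, v} = col u v"
proof -
  define \<chi> where "\<chi> = (\<lambda>e\<in>[{1..n}]\<^bsup>2\<^esup>. col (Min e) (Max e))"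
  have eq: "\<chi> {u, v} = col u v" if uv: "u \<in> {1..n}" "v \<in> {1..n}" "u \<noteq> v" for u v
  proof -
    have "{u, v} \<in> [{1..n}]\<^bsup>2\<^esup>" unfolding doubleton_in_nsets using uv by blast
    then have "\<chi> {u, v} = col (min u v) (max u v)" unfolding \<chi>_def by simp
    also have "\<dots> = col u v" using sym by (cases "u \<le> v") (simp_all add: min_def max_def)
    finally show ?thesis .
  qed
  have "\<chi> e \<in> {1..r}" if e: "e \<in> [{1..n}]\<^bsup>2\<^esup>" for e
  proof -
    have "card e = 2" using e by (simp add: nsets_def)
    then obtain u v where uv: "e = {u, v}" "u \<noteq> v" by (auto simp: card_2_iff)
    with e have "u \<in> {1..n}" "v \<in> {1..n}" unfolding uv doubleton_in_nsets by blast+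
    then show ?thesis using eq uv range by metis
  qed
  moreover have "\<chi> \<in> extensional ([{1..n}]\<^bsup>2\<^esup>)" unfolding \<chi>_def by simp
  ultimately have "\<chi> \<in> edge_colourings n r"
    unfolding edge_colourings_def PiE_def Pi_def by blast
  with eq show ?thesis by blast
qed

lemma mult_add_less: "a * q + c < g * q" if "a < g" "c < q" for a c g q :: nat
proof -
  have "a * q + c < Suc a * q" using that(2) by simp
  also have "\<dots> \<le> g * q" using that(1) by (intro mult_le_mono1) simp
  finally show ?thesis .
qed

text \<open>
  The block construction. Since the family is intersecting, any two vertices have a common
  element to colour their edge with, also when they lie in the same block or have the same
  member of the family. The colour \<open>((i * g + j) * q + c) + 1\<close> encodes the blocks \<open>i \<le> j\<close> and
  the common element \<open>c < q\<close>; all three are recovered by division with remainder. If there are more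
  than \<open>g * card \<T>\<close> vertices, some of them share a label, which does no harm.
\<close>
lemma B_num_ge_intersecting_family:
  assumes n: "n \<ge> 2" and g: "g \<ge> 1"
    and fam: "\<T> \<subseteq> Pow {..<q}" "\<T> \<noteq> {}"
    and inter: "\<And>T T'. T \<in> \<T> \<Longrightarrow> T' \<in> \<T> \<Longrightarrow> T \<inter> T' \<noteq> {}"
    and transversal: "\<And>X. X \<subseteq> {..<q} \<Longrightarrow> \<forall>T\<in>\<T>. X \<inter> T \<noteq> {} \<Longrightarrow> k \<le> card X"
    and vertices: "g * card \<T> \<le> n" and colours: "g * g * q \<le> r"
  shows "g * k \<le> 2 * B_num n r"
proof -
  have finT: "finite \<T>" using fam(1) finite_subset by blast
  have "0 \<in> {..<g}" using g by simp
  then have "{..<g} \<times> \<T> \<noteq> {}" using fam(2) by blast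
  moreover have "card ({..<g} \<times> \<T>) \<le> card {1..n}"
    using vertices by (simp add: card_cartesian_product)
  ultimately have "\<exists>h. h ` {1..n} = {..<g} \<times> \<T>"
    using finT by (intro labelling_exists) auto
  then obtain h where h: "h ` {1..n} = {..<g} \<times> \<T>" by blast
  define blk where "blk v = fst (h v)" for v
  define lst where "lst v = snd (h v)" for v
  have hv: "blk v < g" "lst v \<in> \<T>" if "v \<in> {1..n}" for v
  proof -
    have "h v \<in> {..<g} \<times> \<T>" using that h by blast
    then show "blk v < g" "lst v \<in> \<T>" by (auto simp: blk_def lst_def)
  qed
  have surj: "\<exists>v\<in>{1..n}. blk v = i \<and> lst v = T" if "i < g" "T \<in> \<T>" for i T
  proof -
    have "(i, T) \<in> h ` {1..n}" using that h by blast
    then obtain v where "v \<in> {1..n}" "(i, T) = h v" by blast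
    then show ?thesis unfolding blk_def lst_def by (intro bexI[of _ v]) (auto dest: sym)
  qed
  define com where "com u v = Min (lst u \<inter> lst v)" for u v
  define pr where "pr u v = min (blk u) (blk v) * g + max (blk u) (blk v)" for u v
  define col where "col u v = pr u v * q + com u v + 1" for u v
  have com: "com u v \<in> lst u" "com u v < q" if uv: "u \<in> {1..n}" "v \<in> {1..n}" for u v
  proof -
    have sub: "lst u \<subseteq> {..<q}" using hv(2)[OF uv(1)] fam(1) by blast
    then have "finite (lst u \<inter> lst v)" using finite_subset by blast
    then have "com u v \<in> lst u \<inter> lst v"
      unfolding com_def using inter[OF hv(2)[OF uv(1)] hv(2)[OF uv(2)]] by (rule Min_in)
    then show "com u v \<in> lst u" "com u v < q" using sub by auto
  qed
  have col_sym: "col u v = col v u" for u v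
    unfolding col_def pr_def com_def by (simp only: min.commute max.commute Int_commute)
  have col_range: "col u v \<in> {1..r}" if uv: "u \<in> {1..n}" "v \<in> {1..n}" for u v
  proof -
    have "min (blk u) (blk v) < g" "max (blk u) (blk v) < g"
      using hv(1)[OF uv(1)] hv(1)[OF uv(2)] by simp_all
    then have "pr u v < g * g" unfolding pr_def by (rule mult_add_less)
    then have "pr u v * q + com u v < g * g * q" using com(2)[OF uv] by (rule mult_add_less)
    then show ?thesis using colours unfolding col_def by simp
  qed
  obtain \<chi> where \<chi>: "\<chi> \<in> edge_colourings n r"
    and \<chi>_eq: "\<forall>u\<in>{1..n}. \<forall>v\<in>{1..n}. u \<noteq> v \<longrightarrow> \<chi> {u, v} = col u v"
    using colouring_from_symmetric[of col n r, OF col_sym col_range] by blast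
  define code where "code s = (s - 1) div q" for s
  \<comment> \<open>Rounding \<open>g * k / 2\<close> up instead of down keeps the factor 2 in the conclusion exact.\<close>
  have "(g * k + 1) div 2 \<le> B_num n r"
  proof (rule B_num_ge[OF n \<chi>])
    fix S assume S: "S \<subseteq> {1..r}" and cov: "\<forall>v\<in>{1..n}. \<exists>w. (v, w) \<in> coloured_arcs n \<chi> S"
    have finS: "finite S" using S finite_subset by blast
    have "k \<le> card {s\<in>S. code s div g = i} + card {s\<in>S. code s mod g = i}" if i: "i < g" for i
    proof -
      \<comment> \<open>The colours of \<open>S\<close> that involve the block \<open>i\<close>, and the common elements that they encode.\<close>
      let ?Si = "{s\<in>S. code s div g = i} \<union> {s\<in>S. code s mod g = i}"
      let ?X = "(\<lambda>s. (s - 1) mod q) ` ?Si \<inter> {..<q}"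
      have "?X \<inter> T \<noteq> {}" if T: "T \<in> \<T>" for T
      proof -
        obtain v where v: "v \<in> {1..n}" "blk v = i" "lst v = T" using surj[OF i T] by blast
        obtain w where w: "(v, w) \<in> coloured_arcs n \<chi> S" using cov v(1) by blast
        then have w': "w \<in> {1..n}" "v \<noteq> w" "\<chi> {v, w} \<in> S" by (auto simp: coloured_arcs_def)
        have colS: "col v w \<in> S" using \<chi>_eq[rule_format, OF v(1) w'(1,2)] w'(3) by simp
        have c: "com v w < q" "com v w \<in> T" using com[OF v(1) w'(1)] v(3) by auto
        have code: "code (col v w) = pr v w" and mod: "(col v w - 1) mod q = com v w"
          unfolding code_def col_def using c(1) by simp_all
        have m: "max (blk v) (blk w) < g" using hv(1)[OF v(1)] hv(1)[OF w'(1)] by simp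
        then have "pr v w div g = min (blk v) (blk w)" "pr v w mod g = max (blk v) (blk w)"
          unfolding pr_def by simp_all
        then have "code (col v w) div g = i \<or> code (col v w) mod g = i"
          unfolding code using v(2) by (auto simp: min_def max_def)
        then have "col v w \<in> ?Si" using colS by blast
        then have "com v w \<in> (\<lambda>s. (s - 1) mod q) ` ?Si"
          unfolding mod[symmetric] by (rule imageI)
        then show ?thesis using c by blast
      qed
      then have "k \<le> card ?X" by (intro transversal) auto
      also have "\<dots> \<le> card ((\<lambda>s. (s - 1) mod q) ` ?Si)" using finS by (intro card_mono) auto
      also have "\<dots> \<le> card ?Si" using finS by (intro card_image_le) auto
      also have "\<dots> \<le> card {s\<in>S. code s div g = i} + card {s\<in>S. code s mod g = i}"
        by (rule card_Un_le)
      finally show ?thesis .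
    qed
    \<comment> \<open>A colour involves at most two blocks, once as first and once as second component.\<close>
    then have "(\<Sum>i<g. k) \<le> (\<Sum>i<g. card {s\<in>S. code s div g = i} + card {s\<in>S. code s mod g = i})"
      by (intro sum_mono) simp
    also have "\<dots> = (\<Sum>i<g. card {s\<in>S. code s div g = i}) + (\<Sum>i<g. card {s\<in>S. code s mod g = i})"
      by (rule sum.distrib)
    also have "\<dots> \<le> card S + card S"
      using finS by (intro add_mono sum_card_fibres_le) auto
    finally show "(g * k + 1) div 2 \<le> card S" by simp
  qed
  then show ?thesis by linarith
qed

text \<open>
  The family of all subsets of more than half of \<open>2 k\<close> elements: two such sets meet, and a set with
  fewer than \<open>k\<close> elements misses the member that is its own complement.
\<close>
lemma B_num_ge_blocks:
  assumes n: "n \<ge> 2" and "g \<ge> 1" and k: "k \<ge> 1"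
    and "g * 4 ^ k \<le> n" "g * g * (2 * k) \<le> r"
  shows "g * k \<le> 2 * B_num n r"
proof (rule B_num_ge_intersecting_family[OF n \<open>g \<ge> 1\<close>])
  let ?T = "{T. T \<subseteq> {..<2 * k} \<and> k < card T}"
  show "?T \<subseteq> Pow {..<2 * k}" by blast
  have "{..<2 * k} \<in> ?T" using k by simp
  then show "?T \<noteq> {}" by blast
  show "T \<inter> T' \<noteq> {}" if T: "T \<in> ?T" "T' \<in> ?T" for T T'
  proof
    assume "T \<inter> T' = {}"
    moreover have fin: "finite T" "finite T'" using T finite_subset by blast+
    ultimately have "card (T \<union> T') = card T + card T'" by (simp add: card_Un_disjoint)
    moreover have "card (T \<union> T') \<le> card {..<2 * k}" using T by (intro card_mono) auto
    ultimately show False using T by simp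
  qed
  show "k \<le> card X" if X: "X \<subseteq> {..<2 * k}" "\<forall>T\<in>?T. X \<inter> T \<noteq> {}" for X
  proof (rule ccontr)
    assume "\<not> k \<le> card X"
    moreover have "card ({..<2 * k} - X) = 2 * k - card X"
      using X(1) finite_subset[OF X(1)] by (simp add: card_Diff_subset)
    ultimately have "{..<2 * k} - X \<in> ?T" by auto
    then show False using X(2) by blast
  qed
  have "card ?T \<le> card (Pow {..<2 * k})" by (intro card_mono) auto
  also have "\<dots> = 4 ^ k" by (simp add: card_Pow power_mult)
  finally show "g * card ?T \<le> n" using assms(4) by (meson le_trans mult_le_mono2)
  show "g * g * (2 * k) \<le> r" by fact
qed

section \<open>The two-sided bound\<close>

lemma M_bound_le:
  "M_bound n r \<le> real n" "M_bound n r \<le> real r"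
  "M_bound n r \<le> sqrt (real r * ln (2 + (real n)\<^sup>2 / real r))"
  unfolding M_bound_def by (auto intro: Min_le)

lemma le_M_boundI:
  assumes "a \<le> real n" "a \<le> real r" "a \<le> sqrt (real r * ln (2 + (real n)\<^sup>2 / real r))"
  shows "a \<le> M_bound n r"
  unfolding M_bound_def using assms by simp

lemma A_num_le_M_bound:
  assumes "n \<ge> 1" "r \<ge> 1"
  shows "real (A_num n r) \<le> 6 * M_bound n r"
proof -
  have "real (A_num n r) / 6 \<le> M_bound n r"
  proof (rule le_M_boundI)
    have "real (A_num n r) \<le> real n" "real (A_num n r) \<le> real r"
      using A_num_le_n[OF assms] A_num_le_r[OF assms] by simp_all
    then show "real (A_num n r) / 6 \<le> real n" "real (A_num n r) / 6 \<le> real r" by simp_all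
    show "real (A_num n r) / 6 \<le> sqrt (real r * ln (2 + (real n)\<^sup>2 / real r))"
      using A_num_le_sqrt[OF assms] by simp
  qed
  then show ?thesis by simp
qed

text \<open>
  With so few vertices \<open>k = 1\<close> suffices. The family then has a single member, and the colour of an
  edge tells only which blocks it joins, so that every colour meets at most two blocks.
\<close>
lemma B_num_ge_n:
  assumes n: "n \<ge> 2" and sparse: "(real n)\<^sup>2 \<le> 2 * real r" and r: "r \<ge> 1"
  shows "real n / 16 \<le> real (B_num n r)"
proof (cases "n < 4")
  case True
  then show ?thesis using B_num_ge_1[OF n r] by linarith
next
  case False
  define g where "g = n div 4"
  have g: "g \<ge> 1" "4 * g \<le> n" "n < 8 * g" using False unfolding g_def by presburger+
  have "real (n * n) \<le> real (2 * r)" using sparse by (simp add: power2_eq_square)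
  then have "n * n \<le> 2 * r" unfolding of_nat_le_iff .
  moreover have "(4 * g) * (4 * g) \<le> n * n" using g(2) by (intro mult_le_mono)
  ultimately have "g * g * (2 * 1) \<le> r" by simp
  moreover have "g * 4 ^ 1 \<le> n" using g(2) by simp
  ultimately have "g * 1 \<le> 2 * B_num n r" using B_num_ge_blocks[OF n g(1), of 1 r] by simp
  then show ?thesis using g(3) by linarith
qed

lemma ln_add_2_le:
  assumes "2 \<le> x"
  shows "ln (2 + x) \<le> 2 * ln (x::real)"
proof -
  have "2 * x \<le> x * x" using assms by (intro mult_right_mono) auto
  then have "2 + x \<le> x\<^sup>2" unfolding power2_eq_square using assms by linarith
  then have "ln (2 + x) \<le> ln (x\<^sup>2)" using assms by (subst ln_le_cancel_iff) auto
  also have "\<dots> = 2 * ln x" using assms by (subst ln_realpow) auto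
  finally show ?thesis .
qed

text \<open>
  The bound \<open>g k / 2\<close> is of order \<open>sqrt (r k)\<close>, so \<open>k\<close> should be as large as possible. The number
  \<open>g 4\<^sup>k\<close> of vertices limits \<open>k\<close> to the order of \<open>ln (n\<^sup>2 / r)\<close>, and \<open>g \<ge> 1\<close> limits it to the order
  of \<open>r\<close>; these two limits produce the terms \<open>sqrt (r L)\<close> and \<open>r\<close> of \<open>M(n, r)\<close>.
\<close>
lemma B_num_ge_dense:
  assumes n: "n \<ge> 2" and dense: "2 * real r < (real n)\<^sup>2" and r: "r \<ge> 64"
  shows "M_bound n r \<le> 200 * real (B_num n r)"
proof -
  define x where "x = (real n)\<^sup>2 / real r"
  \<comment> \<open>The divisor 8 leaves room for \<open>4\<^sup>k\<close> below a constant times \<open>sqrt x\<close>, and the divisor 64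
    ensures \<open>k \<le> r / 32\<close> after rounding, so that \<open>y \<ge> 1\<close>. The divisor 4 in \<open>y\<close> makes up for
    the factor 4 that rounding \<open>k\<close> upwards can cost in \<open>4\<^sup>k\<close>.\<close>
  define \<mu> where "\<mu> = min (ln x / 8) (real r / 64)"
  define k where "k = Suc (nat \<lfloor>\<mu>\<rfloor>)"
  define y where "y = sqrt (real r / (2 * real k)) / 4"
  define g where "g = nat \<lfloor>y\<rfloor>"
  have rx: "real r * x = (real n)\<^sup>2" unfolding x_def using r by simp
  have x: "2 < x" unfolding x_def using dense r by (simp add: field_simps)
  then have lam: "0 \<le> \<mu>" unfolding \<mu>_def by simp
  then have k: "\<mu> \<le> real k" "real k \<le> \<mu> + 1" "1 \<le> k" unfolding k_def by linarith+
  have "\<mu> \<le> real r / 64" unfolding \<mu>_def by simp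
  then have k32: "32 * real k \<le> real r" using k(2) r by linarith
  have y2: "y\<^sup>2 = real r / (32 * real k)"
    unfolding y_def using k(3) by (simp add: power_divide field_simps)
  have "1 \<le> y"
  proof -
    have "4\<^sup>2 \<le> real r / (2 * real k)" using k32 k(3) by (simp add: field_simps)
    then have "4 \<le> sqrt (real r / (2 * real k))" by (rule real_le_rsqrt)
    then show ?thesis unfolding y_def by simp
  qed
  then have "real g = of_int \<lfloor>y\<rfloor>" "1 \<le> \<lfloor>y\<rfloor>" unfolding g_def by simp_all
  then have g: "1 \<le> g" "real g \<le> y" "y \<le> 2 * real g" by linarith+
  have few_colours: "g * g * (2 * k) \<le> r"
  proof -
    have "(real g)\<^sup>2 * (2 * real k) \<le> y\<^sup>2 * (2 * real k)"
      using g by (intro mult_right_mono power_mono) auto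
    also have "\<dots> \<le> real r" unfolding y2 using k(3) by (simp add: field_simps)
    finally have "real (g * g * (2 * k)) \<le> real r" by (simp add: power2_eq_square)
    then show ?thesis unfolding of_nat_le_iff .
  qed
  have few_vertices: "g * 4 ^ k \<le> n"
  proof -
    have "(2::real) \<le> exp 1" using exp_ge_add_one_self[of 1] by simp
    then have "(2::real)\<^sup>2 \<le> (exp 1)\<^sup>2" by (intro power_mono) auto
    then have four: "(4::real) \<le> exp 2" by (simp flip: exp_of_nat_mult)
    have "(4::real) ^ nat \<lfloor>\<mu>\<rfloor> \<le> exp 2 ^ nat \<lfloor>\<mu>\<rfloor>" using four by (intro power_mono) auto
    also have "\<dots> = exp (real (nat \<lfloor>\<mu>\<rfloor>) * 2)" by (rule exp_of_nat_mult[symmetric])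
    also have "\<dots> \<le> exp (ln x / 2)"
    proof -
      have "real (nat \<lfloor>\<mu>\<rfloor>) \<le> \<mu>" using lam by simp
      moreover have "\<mu> \<le> ln x / 8" unfolding \<mu>_def by simp
      moreover have "0 \<le> ln x" using x by simp
      ultimately show ?thesis by simp
    qed
    also have "\<dots> = sqrt x" using x by (simp add: ln_sqrt[symmetric])
    finally have pow: "(4::real) ^ k \<le> 4 * sqrt x" unfolding k_def by simp
    have "real r / (2 * real k) \<le> real r / 1" using k(3) by (intro divide_left_mono) auto
    then have "4 * y \<le> sqrt (real r)" unfolding y_def by simp
    then have "real g \<le> sqrt (real r) / 4" using g(2) by simp
    then have "real g * 4 ^ k \<le> (sqrt (real r) / 4) * (4 * sqrt x)"
      using pow by (intro mult_mono) auto
    also have "\<dots> = sqrt (real r * x)" by (simp add: real_sqrt_mult)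
    also have "\<dots> = real n" unfolding rx by simp
    finally have "real (g * 4 ^ k) \<le> real n" by simp
    then show ?thesis unfolding of_nat_le_iff .
  qed
  have "g * k \<le> 2 * B_num n r"
    by (rule B_num_ge_blocks[OF n g(1) k(3) few_vertices few_colours])
  then have gk: "real g * real k \<le> 2 * real (B_num n r)"
    unfolding of_nat_mult[symmetric] by (metis of_nat_le_iff of_nat_mult of_nat_numeral)
  have M0: "0 \<le> M_bound n r"
    using x unfolding x_def by (intro le_M_boundI) auto
  have M2: "(M_bound n r)\<^sup>2 \<le> 64 * (real r * \<mu>)"
  proof (cases "ln x / 8 \<le> real r / 64")
    case True
    have "(M_bound n r)\<^sup>2 \<le> (sqrt (real r * ln (2 + x)))\<^sup>2"
      using M_bound_le(3)[of n r] M0 unfolding x_def by (intro power_mono) auto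
    also have "\<dots> = real r * ln (2 + x)" using x by simp
    also have "\<dots> \<le> real r * (2 * ln x)" using ln_add_2_le[of x] x by (intro mult_left_mono) auto
    also have "\<dots> = 16 * (real r * \<mu>)" using True by (simp add: \<mu>_def)
    also have "\<dots> \<le> 64 * (real r * \<mu>)" using lam by (intro mult_right_mono) auto
    finally show ?thesis .
  next
    case False
    have "(M_bound n r)\<^sup>2 \<le> (real r)\<^sup>2"
      using M_bound_le(2)[of n r] M0 by (intro power_mono) auto
    also have "\<dots> = 64 * (real r * \<mu>)" using False by (simp add: \<mu>_def power2_eq_square)
    finally show ?thesis .
  qed
  have "real r * \<mu> \<le> real r * real k" using k(1) by (intro mult_left_mono) auto
  also have "\<dots> = 32 * (y * real k)\<^sup>2"
    unfolding power_mult_distrib y2 using k(3) by (simp add: field_simps power2_eq_square)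
  also have "(y * real k)\<^sup>2 \<le> (2 * real g * real k)\<^sup>2"
    using g \<open>1 \<le> y\<close> by (intro power_mono mult_right_mono) auto
  also have "(2 * real g * real k)\<^sup>2 \<le> (4 * real (B_num n r))\<^sup>2"
    using gk by (intro power_mono) auto
  finally have "real r * \<mu> \<le> 512 * (real (B_num n r))\<^sup>2" by (simp add: power_mult_distrib)
  moreover have "(200 * real (B_num n r))\<^sup>2 = 40000 * (real (B_num n r))\<^sup>2"
    by (simp add: power_mult_distrib)
  ultimately have "(M_bound n r)\<^sup>2 \<le> (200 * real (B_num n r))\<^sup>2"
    using M2 zero_le_power2[of "real (B_num n r)"] by linarith
  then show ?thesis by (rule power2_le_imp_le) simp
qed

lemma M_bound_le_B_num:
  assumes n: "n \<ge> 2" and r: "r \<ge> 1"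
  shows "M_bound n r \<le> 200 * real (B_num n r)"
proof -
  consider "(real n)\<^sup>2 \<le> 2 * real r" | "r < 64" | "2 * real r < (real n)\<^sup>2" "r \<ge> 64" by linarith
  then show ?thesis
  proof cases
    case 1
    then show ?thesis using B_num_ge_n[OF n 1 r] M_bound_le(1)[of n r] by linarith
  next
    case 2
    then show ?thesis using B_num_ge_1[OF n r] M_bound_le(2)[of n r] by linarith
  next
    case 3
    then show ?thesis by (rule B_num_ge_dense[OF n])
  qed
qed

lemma num_bounds:
  assumes "F \<in> {A_num, B_num}" "n \<ge> 2" "r \<ge> 1"
  shows "M_bound n r \<le> 200 * real (F n r)" "real (F n r) \<le> 6 * M_bound n r"
proof -
  have "M_bound n r \<le> 200 * real (B_num n r)" by (rule M_bound_le_B_num[OF assms(2,3)])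
  moreover have "real (B_num n r) \<le> real (A_num n r)"
    using B_num_le_A_num[OF assms(2,3)] by simp
  moreover have "real (A_num n r) \<le> 6 * M_bound n r"
    using assms(2,3) by (intro A_num_le_M_bound) auto
  ultimately show "M_bound n r \<le> 200 * real (F n r)" "real (F n r) \<le> 6 * M_bound n r"
    using assms(1) by auto
qed

section \<open>The three regimes\<close>

lemma M_bound_ge_n:
  assumes n: "n \<ge> 2" and r: "r \<ge> 1" and "real n \<le> sqrt (2 * real r)"
  shows "real n / 2 \<le> M_bound n r"
proof (rule le_M_boundI)
  have "(real n)\<^sup>2 \<le> (sqrt (2 * real r))\<^sup>2" using assms(3) by (intro power_mono) auto
  then have n2: "(real n)\<^sup>2 \<le> 2 * real r" by simp
  have "2 * real n \<le> real n * real n" using n by (intro mult_right_mono) auto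
  then show "real n / 2 \<le> real r" using n2 unfolding power2_eq_square by linarith
  show "real n / 2 \<le> sqrt (real r * ln (2 + (real n)\<^sup>2 / real r))"
  proof (rule real_le_rsqrt)
    have "ln 2 \<le> ln (2 + (real n)\<^sup>2 / real r)"
      by (subst ln_le_cancel_iff) (auto intro: add_pos_nonneg)
    then have "1 / 2 \<le> ln (2 + (real n)\<^sup>2 / real r)" using ln_2_ge_half by linarith
    then have "real r * (1 / 2) \<le> real r * ln (2 + (real n)\<^sup>2 / real r)"
      by (intro mult_left_mono) auto
    then show "(real n / 2)\<^sup>2 \<le> real r * ln (2 + (real n)\<^sup>2 / real r)"
      using n2 by (simp add: power_divide)
  qed
qed simp

text \<open>
  Here \<open>x = n\<^sup>2 / r > 2\<close>, so \<open>ln x\<close> and \<open>ln (2 + x)\<close> agree up to a factor 2. The other two terms of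
  the minimum are not smaller: \<open>ln x \<le> x\<close> compares with \<open>n = sqrt (r x)\<close>, and
  \<open>ln x \<le> 2 ln n \<le> 2 r ln 1.01 \<le> r\<close> compares with \<open>r\<close>.
\<close>
lemma M_bound_middle:
  assumes n: "n \<ge> 2" and r: "r \<ge> 1"
    and lower: "sqrt (2 * real r) < real n" and upper: "real n < (1.01 :: real) ^ r"
  shows "sqrt (real r * ln ((real n)\<^sup>2 / real r)) \<le> M_bound n r"
    and "M_bound n r \<le> 2 * sqrt (real r * ln ((real n)\<^sup>2 / real r))"
proof -
  define x where "x = (real n)\<^sup>2 / real r"
  have rx: "real r * x = (real n)\<^sup>2" unfolding x_def using r by simp
  have "(sqrt (2 * real r))\<^sup>2 < (real n)\<^sup>2" using lower by (intro power_strict_mono) auto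
  then have x: "2 < x" unfolding x_def using r by (simp add: field_simps)
  have "sqrt (real r * ln x) \<le> M_bound n r"
  proof (rule le_M_boundI)
    have "ln x \<le> x" using x ln_le_minus_one[of x] by linarith
    then have "real r * ln x \<le> (real n)\<^sup>2" unfolding rx[symmetric] by (intro mult_left_mono) auto
    then show "sqrt (real r * ln x) \<le> real n" by (intro real_le_lsqrt) auto
    have "x \<le> (real n)\<^sup>2" unfolding x_def using r by (simp add: field_simps mult_le_cancel_right1)
    then have "ln x \<le> ln ((real n)\<^sup>2)" using x n by (subst ln_le_cancel_iff) auto
    also have "\<dots> = 2 * ln (real n)" using n by (subst ln_realpow) auto
    also have "ln (real n) \<le> ln (1.01 ^ r)" using upper n by (subst ln_le_cancel_iff) auto
    also have "ln (1.01 ^ r :: real) = real r * ln 1.01" by (subst ln_realpow) auto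
    also have "real r * ln (1.01 :: real) \<le> real r * 0.01"
      using ln_le_minus_one[of "1.01 :: real"] by (intro mult_left_mono) auto
    finally have "ln x \<le> real r" by simp
    then have "real r * ln x \<le> (real r)\<^sup>2" unfolding power2_eq_square by (intro mult_left_mono) auto
    then show "sqrt (real r * ln x) \<le> real r" by (intro real_le_lsqrt) auto
    show "sqrt (real r * ln x) \<le> sqrt (real r * ln (2 + (real n)\<^sup>2 / real r))"
      unfolding x_def[symmetric] using x by (intro real_sqrt_le_mono mult_left_mono) auto
  qed
  then show "sqrt (real r * ln ((real n)\<^sup>2 / real r)) \<le> M_bound n r" unfolding x_def .
  have "M_bound n r \<le> sqrt (real r * ln (2 + x))" using M_bound_le(3) unfolding x_def .
  also have "\<dots> \<le> sqrt (2\<^sup>2 * (real r * ln x))"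
  proof (rule real_sqrt_le_mono)
    have "real r * ln (2 + x) \<le> real r * (2 * ln x)"
      using ln_add_2_le[of x] x by (intro mult_left_mono) auto
    also have "\<dots> \<le> 2\<^sup>2 * (real r * ln x)" using x by simp
    finally show "real r * ln (2 + x) \<le> 2\<^sup>2 * (real r * ln x)" .
  qed
  also have "\<dots> = 2 * sqrt (real r * ln x)" by (simp add: real_sqrt_mult)
  finally show "M_bound n r \<le> 2 * sqrt (real r * ln ((real n)\<^sup>2 / real r))" unfolding x_def .
qed

text \<open>
  Exponentially many vertices make the logarithm linear in \<open>r\<close>. To deal with the division by \<open>r\<close>,
  one factor of \<open>n\<^sup>2 \<ge> y\<^sup>2\<close>, where \<open>y = 1.01 ^ r\<close>, is used against \<open>r \<le> 100 y\<close>; this leaves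
  \<open>2 + n\<^sup>2 / r \<ge> 2 + y / 100\<close>, whose sixth power is at least \<open>y\<close>.
\<close>
lemma M_bound_ge_r:
  assumes r: "r \<ge> 1" and huge: "(1.01 :: real) ^ r \<le> real n"
  shows "real r / 100 \<le> M_bound n r"
proof (rule le_M_boundI)
  define y where "y = (1.01 :: real) ^ r"
  have "(1.01 :: real) = 1 + 0.01" by simp
  then have "1 + real r * 0.01 \<le> y"
    unfolding y_def by (simp only:) (rule Bernoulli_inequality, simp)
  then have y: "real r / 100 \<le> y" "0 < y" by simp_all
  have yn: "y \<le> real n" using huge unfolding y_def .
  then show "real r / 100 \<le> real n" using y by simp
  have "y / 100 * real r \<le> y * y" using y by (simp add: field_simps)
  also have "\<dots> \<le> (real n)\<^sup>2" unfolding power2_eq_square using y yn by (intro mult_mono) auto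
  finally have ratio: "y / 100 \<le> (real n)\<^sup>2 / real r" using r by (simp add: field_simps)
  define a where "a = y / 100"
  have a: "0 < a" "y = 100 * a" unfolding a_def using y(2) by simp_all
  have "8 * a * 2 ^ 4 \<le> (2 + a)\<^sup>2 * (2 + a) ^ 4"
  proof (intro mult_mono)
    show "8 * a \<le> (2 + a)\<^sup>2"
      using zero_le_power2[of "2 - a"] by (simp add: power2_eq_square algebra_simps)
    show "2 ^ 4 \<le> (2 + a) ^ 4" using a by (intro power_mono) auto
  qed simp_all
  then have "y \<le> (2 + a) ^ 6" using a by (simp flip: power_add)
  also have "\<dots> \<le> (2 + (real n)\<^sup>2 / real r) ^ 6"
  proof (rule power_mono)
    show "2 + a \<le> 2 + (real n)\<^sup>2 / real r" using ratio unfolding a_def by simp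
    show "0 \<le> 2 + a" using a by simp
  qed
  finally have "ln y \<le> ln ((2 + (real n)\<^sup>2 / real r) ^ 6)" using y(2) by (subst ln_le_cancel_iff) auto
  also have "\<dots> = 6 * ln (2 + (real n)\<^sup>2 / real r)"
    by (subst ln_realpow) (auto intro: add_pos_nonneg)
  finally have L: "ln y \<le> 6 * ln (2 + (real n)\<^sup>2 / real r)" .
  have "1 / 200 \<le> ln (1.01 :: real)"
    using ln_le_minus_one[of "1 / 1.01 :: real"] by (simp add: ln_div)
  then have "real r * (1 / 200) \<le> real r * ln 1.01" by (intro mult_left_mono) auto
  also have "\<dots> = ln y" unfolding y_def by (rule ln_realpow[symmetric])
  finally have "real r / 10000 \<le> ln (2 + (real n)\<^sup>2 / real r)" using L by simp
  then have "real r * (real r / 10000) \<le> real r * ln (2 + (real n)\<^sup>2 / real r)"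
    by (intro mult_left_mono) auto
  then show "real r / 100 \<le> sqrt (real r * ln (2 + (real n)\<^sup>2 / real r))"
    by (intro real_le_rsqrt) (simp add: power2_eq_square)
  show "real r / 100 \<le> real r" by simp
qed

theorem theorem1p1:
  shows
    "(\<exists>c C :: real. 0 < c \<and> c \<le> C \<and>
        (\<forall>n r :: nat. n \<ge> 2 \<and> r \<ge> 1 \<longrightarrow>
           c * M_bound n r \<le> real (A_num n r) \<and> real (A_num n r) \<le> C * M_bound n r \<and>
           c * M_bound n r \<le> real (B_num n r) \<and> real (B_num n r) \<le> C * M_bound n r))
     \<and>
     (\<exists>c' C' :: real. 0 < c' \<and> c' \<le> C' \<and>
        (\<forall>n r :: nat. \<forall>F \<in> {A_num, B_num}. n \<ge> 2 \<and> r \<ge> 1 \<longrightarrow>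
           (real n \<le> sqrt (2 * real r) \<longrightarrow>
              c' * real n \<le> real (F n r) \<and> real (F n r) \<le> C' * real n) \<and>
           (sqrt (2 * real r) < real n \<and> real n < (1.01 :: real) ^ r \<longrightarrow>
              c' * sqrt (real r * ln ((real n)\<^sup>2 / real r)) \<le> real (F n r) \<and>
              real (F n r) \<le> C' * sqrt (real r * ln ((real n)\<^sup>2 / real r))) \<and>
           (real n \<ge> (1.01 :: real) ^ r \<longrightarrow>
              c' * real r \<le> real (F n r) \<and> real (F n r) \<le> C' * real r)))"
proof (rule conjI, goal_cases)
  case 1
  show ?case
  proof (rule exI[of _ "1 / 200"], rule exI[of _ 6], intro conjI allI impI)
    fix n r :: nat assume nr: "n \<ge> 2 \<and> r \<ge> 1"
    show "1 / 200 * M_bound n r \<le> real (A_num n r)" "real (A_num n r) \<le> 6 * M_bound n r"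
      "1 / 200 * M_bound n r \<le> real (B_num n r)" "real (B_num n r) \<le> 6 * M_bound n r"
      using num_bounds[of A_num n r] num_bounds[of B_num n r] nr by simp_all
  qed simp_all
next
  case 2
  show ?case
  proof (rule exI[of _ "1 / 20000"], rule exI[of _ 12], intro conjI allI ballI impI)
    fix n r :: nat and F assume F: "F \<in> {A_num, B_num}" and nr: "n \<ge> 2 \<and> r \<ge> 1"
    then have n: "n \<ge> 2" and r: "r \<ge> 1" by simp_all
    note F = num_bounds[OF F n r]
    note M = M_bound_le(1,2)[of n r]
    {
      assume "real n \<le> sqrt (2 * real r)"
      then have "real n / 2 \<le> M_bound n r" by (rule M_bound_ge_n[OF n r])
      then show "1 / 20000 * real n \<le> real (F n r)" "real (F n r) \<le> 12 * real n"
        using F M by linarith+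
    next
      assume "sqrt (2 * real r) < real n \<and> real n < (1.01 :: real) ^ r"
      then have lower: "sqrt (2 * real r) < real n" and upper: "real n < (1.01 :: real) ^ r"
        by blast+
      note mid = M_bound_middle[OF n r lower upper]
      have "0 \<le> real (F n r)" by simp
      then show "1 / 20000 * sqrt (real r * ln ((real n)\<^sup>2 / real r)) \<le> real (F n r)"
        using mid(1) F(1) by linarith
      show "real (F n r) \<le> 12 * sqrt (real r * ln ((real n)\<^sup>2 / real r))"
        using mid(2) F(2) by linarith
    next
      assume "(1.01 :: real) ^ r \<le> real n"
      then have "real r / 100 \<le> M_bound n r" by (rule M_bound_ge_r[OF r])
      then show "1 / 20000 * real r \<le> real (F n r)" "real (F n r) \<le> 12 * real r"
        using F M by linarith+
    }
  qed simp_all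
qed

end
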